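(* Let $X$ be a locally connected Hausdorff topological space. Then the map $\varphi$ from $(MU(X,\mathbb{R}),V)$ onto $(MC(X,\mathbb{R}),V)$, defined by $\varphi(F)(x)=\overline{co}\,F(x)$ for all $x\in X$, is continuous, where $V$ denotes the Vietoris topology.
   Context: A set-valued map $F$ from $X$ to $\mathbb{R}$ assigns to each $x\in X$ a subset $F(x)\subset\mathbb{R}$; it is identified with its graph $\{(x,y)\in X\times\mathbb{R}: y\in F(x)\}$. $\mathbb{R}$ has its usual metric. Write $G\subset F$ if $G(x)\subset F(x)$ for all $x\in X$. $F$ is upper semicontinuous if for every $x\in X$ and every open $O\supset F(x)$ there is an open neighborhood $U$ of $x$ with $F(u)\subset O$ for all $u\in U$. $F$ is usco if it is upper semicontinuous and all its values are nonempty and compact; $F$ is cusco if it is usco and all its values are convex. $F$ is minimal usco (minimal cusco) if it is usco (cusco) and does not properly contain any other usco (cusco) map from $X$ to $\mathbb{R}$. $MU(X,\mathbb{R})$ and $MC(X,\mathbb{R})$ denote the sets of all minimal usco and all minimal cusco maps from $X$ to $\mathbb{R}$, respectively. $\overline{co}\,B$ denotes the closed convex hull of $B$. Let $CL(X\times\mathbb{R})$ be the set of all nonempty closed subsets of $X\times\mathbb{R}$. The Vietoris topology $V$ on $CL(X\times\mathbb{R})$ has as basic open sets $W^+\cap W_1^-\cap\dots\cap W_n^-$, where $W,W_1,\dots,W_n$ are open subsets of $X\times\mathbb{R}$, $W^+=\{F\in CL(X\times\mathbb{R}): F\subset W\}$ and $W_i^-=\{F\in CL(X\times\mathbb{R}):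 F\cap W_i\neq\emptyset\}$. Identifying maps with their graphs, $MU(X,\mathbb{R})$ and $MC(X,\mathbb{R})$ are regarded as subsets of $CL(X\times\mathbb{R})$ and carry the induced Vietoris topology $V$. *)

theory Defs
  imports "HOL-Analysis.Analysis"
begin

text \<open>A set-valued map from \<open>X\<close> to the reals is represented by its graph, a subset \<open>F\<close> of
  \<open>topspace X \<times> UNIV\<close>. The value \<open>F(x)\<close> is the relational image \<open>F `` {x}\<close>, and the inclusion
  of maps is the inclusion of graphs.\<close>

definition usc_map :: "'a topology \<Rightarrow> ('a \<times> real) set \<Rightarrow> bool" where
  "usc_map X F \<longleftrightarrow> F \<subseteq> topspace X \<times> UNIV \<and>
     (\<forall>x\<in>topspace X. \<forall>V. open V \<and> F `` {x} \<subseteq> V \<longrightarrow>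
        (\<exists>U. openin X U \<and> x \<in> U \<and> (\<forall>u\<in>U. F `` {u} \<subseteq> V)))"

definition usco :: "'a topology \<Rightarrow> ('a \<times> real) set \<Rightarrow> bool" where
  "usco X F \<longleftrightarrow> usc_map X F \<and> (\<forall>x\<in>topspace X. F `` {x} \<noteq> {} \<and> compact (F `` {x}))"

definition cusco :: "'a topology \<Rightarrow> ('a \<times> real) set \<Rightarrow> bool" where
  "cusco X F \<longleftrightarrow> usco X F \<and> (\<forall>x\<in>topspace X. convex (F `` {x}))"

definition MU :: "'a topology \<Rightarrow> ('a \<times> real) set set" where
  "MU X = {F. usco X F \<and> \<not> (\<exists>G. usco X G \<and> G \<subset> F)}"

definition MC :: "'a topology \<Rightarrow> ('a \<times> real) set set" where
  "MC X = {F. cusco X F \<and> \<not> (\<exists>G. cusco X G \<and> G \<subset> F)}"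

definition CL :: "'a topology \<Rightarrow> 'a set set" where
  "CL Z = {C. closedin Z C \<and> C \<noteq> {}}"

definition vietoris_basic :: "'a topology \<Rightarrow> 'a set \<Rightarrow> 'a set set \<Rightarrow> 'a set set" where
  "vietoris_basic Z W \<W> = {C \<in> CL Z. C \<subseteq> W \<and> (\<forall>V\<in>\<W>. C \<inter> V \<noteq> {})}"

text \<open>The empty family \<open>\<W>\<close> is allowed; since the members of \<open>CL Z\<close> are nonempty,
  it gives the same set as the family consisting of \<open>topspace Z\<close> alone.\<close>

definition vietoris_base :: "'a topology \<Rightarrow> 'a set set set" where
  "vietoris_base Z = {vietoris_basic Z W \<W> | W \<W>.
     openin Z W \<and> finite \<W> \<and> (\<forall>V\<in>\<W>. openin Z V)}"

definition vietoris :: "'a topology \<Rightarrow> 'a set topology" where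
  "vietoris Z = topology_generated_by (vietoris_base Z)"

definition co_map :: "'a topology \<Rightarrow> ('a \<times> real) set \<Rightarrow> ('a \<times> real) set" where
  "co_map X F = (SIGMA x:topspace X. closure (convex hull (F `` {x})))"

lemma topspace_vietoris [simp]: "topspace (vietoris Z) = CL Z"
proof -
  have "vietoris_basic Z (topspace Z) {} = CL Z"
    by (auto simp: vietoris_basic_def CL_def dest: closedin_subset)
  then have "CL Z \<in> vietoris_base Z"
    unfolding vietoris_base_def by fastforce
  moreover have "\<Union> (vietoris_base Z) \<subseteq> CL Z"
    by (auto simp: vietoris_base_def vietoris_basic_def)
  ultimately show ?thesis
    unfolding vietoris_def topology_generated_by_topspace by blast
qed

lemma vietoris_basic_Int:
  "vietoris_basic Z W \<W> \<inter> vietoris_basic Z W' \<W>' = vietoris_basic Z (W \<inter> W') (\<W> \<union> \<W>')"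
  by (auto simp: vietoris_basic_def)

text \<open>The basic sets form a base, not only a subbase.\<close>

lemma openin_vietoris_iff:
  "openin (vietoris Z) S \<longleftrightarrow> (\<exists>\<B>\<subseteq>vietoris_base Z. S = \<Union>\<B>)"
proof
  have base_Int: "A \<inter> B \<in> vietoris_base Z" if AB: "A \<in> vietoris_base Z" "B \<in> vietoris_base Z" for A B
  proof -
    obtain W \<W> where A: "A = vietoris_basic Z W \<W>" "openin Z W" "finite \<W>" "\<forall>V\<in>\<W>. openin Z V"
      using AB(1) unfolding vietoris_base_def by blast
    obtain W' \<W>' where B: "B = vietoris_basic Z W' \<W>'" "openin Z W'" "finite \<W>'" "\<forall>V\<in>\<W>'. openin Z V"
      using AB(2) unfolding vietoris_base_def by blast
    have "openin Z (W \<inter> W')" "finite (\<W> \<union> \<W>')" "\<forall>V\<in>\<W> \<union> \<W>'. openin Z V"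
      using A B by auto
    then show ?thesis
      unfolding A(1) B(1) vietoris_basic_Int vietoris_base_def by blast
  qed
  assume "openin (vietoris Z) S"
  then have "generate_topology_on (vietoris_base Z) S"
    unfolding vietoris_def by (rule openin_topology_generated_by)
  then have "\<forall>x\<in>S. \<exists>B\<in>vietoris_base Z. x \<in> B \<and> B \<subseteq> S"
  proof induction
    case (Int a b)
    show ?case
    proof
      fix x assume "x \<in> a \<inter> b"
      then obtain A B where "A \<in> vietoris_base Z" "x \<in> A" "A \<subseteq> a"
          "B \<in> vietoris_base Z" "x \<in> B" "B \<subseteq> b"
        using Int.IH by blast
      then show "\<exists>C\<in>vietoris_base Z. x \<in> C \<and> C \<subseteq> a \<inter> b"
        using base_Int by (intro bexI[of _ "A \<inter> B"]) auto
    qed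
  next
    case (UN K)
    then show ?case by (meson Union_iff Union_upper order_trans)
  qed auto
  then have "S = \<Union>{B \<in> vietoris_base Z. B \<subseteq> S}"
    by blast
  then show "\<exists>\<B>\<subseteq>vietoris_base Z. S = \<Union>\<B>"
    by (intro exI[of _ "{B \<in> vietoris_base Z. B \<subseteq> S}"]) auto
next
  assume "\<exists>\<B>\<subseteq>vietoris_base Z. S = \<Union>\<B>"
  then show "openin (vietoris Z) S"
    unfolding vietoris_def by (metis openin_Union subsetD topology_generated_by_Basis)
qed

lemma usco_closedin:
  assumes "usco X F"
  shows "closedin (prod_topology X euclideanreal) F"
  unfolding closedin_def
proof
  have F: "F \<subseteq> topspace X \<times> UNIV"
    using assms by (simp add: usco_def usc_map_def)
  then show "F \<subseteq> topspace (prod_topology X euclideanreal)"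
    by simp
  show "openin (prod_topology X euclideanreal) (topspace (prod_topology X euclideanreal) - F)"
  proof (subst openin_prod_topology_alt, intro allI impI)
    fix x y assume "(x, y) \<in> topspace (prod_topology X euclideanreal) - F"
    then have x: "x \<in> topspace X" and y: "y \<notin> F `` {x}"
      by auto
    have "closed (F `` {x})"
      using assms x by (simp add: usco_def compact_imp_closed)
    then obtain e where e: "e > 0" "cball y e \<subseteq> - (F `` {x})"
      using y open_contains_cball[of "- (F `` {x})"] by blast
    have "open (- cball y e)" "F `` {x} \<subseteq> - cball y e"
      using e(2) by (auto simp del: mem_cball)
    then obtain U where U: "openin X U" "x \<in> U" "\<forall>u\<in>U. F `` {u} \<subseteq> - cball y e"
      using assms x unfolding usco_def usc_map_def by meson
    have "U \<times> ball y e \<subseteq> topspace (prod_topology X euclideanreal) - F"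
      using U(3) openin_subset[OF U(1)] ball_subset_cball[of y e] by (fastforce simp del: mem_cball mem_ball)
    then show "\<exists>U V. openin X U \<and> openin euclideanreal V \<and> x \<in> U \<and> y \<in> V \<and>
        U \<times> V \<subseteq> topspace (prod_topology X euclideanreal) - F"
      using U e(1) by (intro exI[of _ U] exI[of _ "ball y e"]) auto
  qed
qed

lemma usco_in_CL:
  assumes "usco X F" "topspace X \<noteq> {}"
  shows "F \<in> CL (prod_topology X euclideanreal)"
proof -
  have "F \<noteq> {}"
    using assms by (force simp: usco_def)
  then show ?thesis
    using usco_closedin[OF assms(1)] by (simp add: CL_def)
qed

end

theory Submission
  imports Defs
begin

text \<open>That \<open>co_map\<close> maps \<open>MU X\<close> onto \<open>MC X\<close> rests on one property of a minimal usco map \<open>F\<close>: if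
  \<open>F\<close> meets an open box \<open>U \<times> V\<close>, then \<open>F(w) \<subseteq> V\<close> for some \<open>w \<in> U\<close>, as otherwise removing the box
  from \<open>F\<close> leaves a smaller usco map.

  Continuity does not use minimality. If \<open>co F \<subseteq> W\<close>, then the open boxes \<open>U \<times> {a<..<b} \<subseteq> W\<close> with
  \<open>F(u) \<subseteq> {a<..<b}\<close> for all \<open>u \<in> U\<close> cover \<open>F\<close>, and the intervals of the boxes over a fixed point
  all contain \<open>F(u)\<close>, so that their union is convex. If \<open>co F\<close> meets \<open>U \<times> {a<..<b}\<close> with \<open>U\<close>
  connected, then \<open>F\<close> meets \<open>U \<times> {a<..}\<close> and \<open>U \<times> {..<b}\<close>; conversely, if \<open>G\<close> meets both, then
  \<open>co G\<close> meets \<open>U \<times> {a<..<b}\<close>, for otherwise upper semicontinuity splits \<open>U\<close> into the two open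
  parts where \<open>co G\<close> lies below \<open>a\<close> and above \<open>b\<close>.\<close>

section \<open>Usco maps and their convex hulls\<close>

lemma usco_nbhd:
  assumes "usco X F" "x \<in> topspace X" "open V" "F `` {x} \<subseteq> V"
  obtains U where "openin X U" "x \<in> U" "\<And>u. u \<in> U \<Longrightarrow> F `` {u} \<subseteq> V"
  using assms unfolding usco_def usc_map_def by meson

lemma usco_compact: "usco X F \<Longrightarrow> x \<in> topspace X \<Longrightarrow> compact (F `` {x})"
  and usco_nonempty: "usco X F \<Longrightarrow> x \<in> topspace X \<Longrightarrow> F `` {x} \<noteq> {}"
  and usco_subset: "usco X F \<Longrightarrow> F \<subseteq> topspace X \<times> UNIV"
  by (auto simp: usco_def usc_map_def)

text \<open>In the reals the convex hull of a compact set is compact, hence already closed, so the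
  closure in \<open>co_map\<close> adds nothing.\<close>

lemma co_map_image:
  assumes "usco X F" "x \<in> topspace X"
  shows "co_map X F `` {x} = convex hull (F `` {x})"
  using assms compact_imp_closed[OF compact_convex_hull[OF usco_compact[OF assms]]]
  by (auto simp: co_map_def)

lemma co_map_iff:
  assumes "usco X F"
  shows "(x, y) \<in> co_map X F \<longleftrightarrow> x \<in> topspace X \<and> y \<in> convex hull (F `` {x})"
  using co_map_image[OF assms] by (auto simp: co_map_def)

lemma subset_co_map:
  assumes "usco X F"
  shows "F \<subseteq> co_map X F"
  using usco_subset[OF assms] by (auto simp: co_map_iff[OF assms] intro: hull_inc)

text \<open>The hull is a compact interval, and small balls around its two endpoints stay in
  \<open>V\<close>. Replacing \<open>V\<close> by an open interval is useful because an interval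
  that contains a value of a map also contains the hull of that value.\<close>

lemma compact_convex_hull_subset_interval:
  fixes K V :: "real set"
  assumes "compact K" "K \<noteq> {}" "open V" "convex hull K \<subseteq> V"
  obtains a b where "K \<subseteq> {a<..<b}" "{a<..<b} \<subseteq> V"
proof -
  have "convex (convex hull K)" "compact (convex hull K)" "convex hull K \<noteq> {}"
    using assms by (auto simp: compact_convex_hull)
  then obtain m M where mM: "convex hull K = {m..M}"
    by (metis connected_compact_interval_1 convex_connected)
  with assms(2) have "m \<le> M"
    by auto
  then have "m \<in> V" "M \<in> V"
    using assms(4) mM by auto
  then obtain d e where "d > 0" "ball m d \<subseteq> V" "e > 0" "ball M e \<subseteq> V"
    using assms(3) open_contains_ball by metis
  then have "{m - d<..<M + e} \<subseteq> V"
    using mM assms(4) by (force simp: ball_eq_greaterThanLessThan)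
  moreover have "K \<subseteq> {m - d<..<M + e}"
    using hull_subset[of K convex] mM \<open>d > 0\<close> \<open>e > 0\<close> by auto
  ultimately show ?thesis
    using that by blast
qed

lemma cusco_co_map:
  assumes "usco X F"
  shows "cusco X (co_map X F)"
proof -
  have "\<exists>U. openin X U \<and> x \<in> U \<and> (\<forall>u\<in>U. co_map X F `` {u} \<subseteq> V)"
    if x: "x \<in> topspace X" and V: "open V" "co_map X F `` {x} \<subseteq> V" for x V
  proof -
    obtain a b where ab: "F `` {x} \<subseteq> {a<..<b}" "{a<..<b} \<subseteq> V"
      using compact_convex_hull_subset_interval usco_compact usco_nonempty assms x V
        co_map_image[OF assms x] by metis
    then obtain U where U: "openin X U" "x \<in> U" "\<And>u. u \<in> U \<Longrightarrow> F `` {u} \<subseteq> {a<..<b}"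
      using usco_nbhd[OF assms x, of "{a<..<b}"] by auto
    have "co_map X F `` {u} \<subseteq> V" if "u \<in> U" for u
    proof -
      have "co_map X F `` {u} = convex hull (F `` {u})"
        using co_map_image[OF assms] openin_subset[OF U(1)] that by blast
      also have "\<dots> \<subseteq> {a<..<b}"
        using U(3)[OF that] by (intro hull_minimal) auto
      finally show ?thesis
        using ab(2) by simp
    qed
    then show ?thesis
      using U by blast
  qed
  moreover have "co_map X F \<subseteq> topspace X \<times> UNIV"
    by (auto simp: co_map_def)
  ultimately show ?thesis
    using co_map_image[OF assms] usco_compact[OF assms] usco_nonempty[OF assms]
    by (auto simp: cusco_def usco_def usc_map_def compact_convex_hull)
qed

lemma co_map_subset_cusco:
  assumes "usco X F" "cusco X G" "F \<subseteq> G"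
  shows "co_map X F \<subseteq> G"
proof clarify
  fix x y assume "(x, y) \<in> co_map X F"
  then have "x \<in> topspace X" "y \<in> convex hull (F `` {x})"
    by (auto simp: co_map_iff[OF assms(1)])
  moreover from this have "convex (G `` {x})" "F `` {x} \<subseteq> G `` {x}"
    using assms by (auto simp: cusco_def)
  ultimately show "(x, y) \<in> G"
    using hull_minimal by blast
qed

section \<open>Minimal usco and minimal cusco maps\<close>

text \<open>At a point of \<open>U\<close>, apply upper semicontinuity to
  \<open>Q \<union> V\<close> and stay inside \<open>U\<close>, where \<open>V\<close> is removed.
  At a point outside \<open>U\<close> the value is unchanged and nearby values only shrink. The
  assumption \<open>ne\<close> keeps the values nonempty.\<close>

lemma usco_Diff_box:
  assumes F: "usco X F" and U: "openin X U" and V: "open V"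
    and ne: "\<And>u. u \<in> U \<Longrightarrow> \<not> F `` {u} \<subseteq> V"
  shows "usco X (F - U \<times> V)"
proof -
  have im: "(F - U \<times> V) `` {x} = (if x \<in> U then F `` {x} - V else F `` {x})" for x
    by auto
  have "\<exists>N. openin X N \<and> x \<in> N \<and> (\<forall>u\<in>N. (F - U \<times> V) `` {u} \<subseteq> Q)"
    if x: "x \<in> topspace X" and Q: "open Q" "(F - U \<times> V) `` {x} \<subseteq> Q" for x Q
  proof (cases "x \<in> U")
    case True
    then obtain N where "openin X N" "x \<in> N" "\<And>u. u \<in> N \<Longrightarrow> F `` {u} \<subseteq> Q \<union> V"
      using usco_nbhd[OF F x, of "Q \<union> V"] Q V im[of x] by auto
    then show ?thesis
      using U True by (intro exI[of _ "N \<inter> U"]) (auto simp: im)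
  next
    case False
    then obtain N where "openin X N" "x \<in> N" "\<And>u. u \<in> N \<Longrightarrow> F `` {u} \<subseteq> Q"
      using usco_nbhd[OF F x, of Q] Q im[of x] by auto
    then show ?thesis
      by (intro exI[of _ N]) auto
  qed
  moreover have "(F - U \<times> V) `` {x} \<noteq> {}" "compact ((F - U \<times> V) `` {x})"
    if "x \<in> topspace X" for x
    using usco_nonempty[OF F that] usco_compact[OF F that] ne[of x] V
    unfolding im by (auto simp: compact_diff)
  ultimately show ?thesis
    using usco_subset[OF F] by (auto simp: usco_def usc_map_def)
qed

lemma MU_box:
  assumes F: "F \<in> MU X" and U: "openin X U" and V: "open V" and "F \<inter> U \<times> V \<noteq> {}"
  obtains w where "w \<in> U" "F `` {w} \<subseteq> V"
proof -
  have "F - U \<times> V \<subset> F"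
    using assms(4) by blast
  then have "\<not> usco X (F - U \<times> V)"
    using F by (auto simp: MU_def)
  then show ?thesis
    using usco_Diff_box[of X F U V] F U V that by (auto simp: MU_def)
qed

text \<open>It suffices that a cusco map \<open>H\<close> below \<open>co_map X F\<close> contains
  \<open>F\<close>, since it then contains \<open>co_map X F\<close>. A point of \<open>F\<close>
  missed by \<open>H\<close> has a box around it that \<open>H\<close> avoids, while
  \<open>MU_box\<close> forces some value of \<open>H\<close> into that box.\<close>

lemma co_map_MU:
  assumes F: "F \<in> MU X"
  shows "co_map X F \<in> MC X"
proof -
  have uF: "usco X F"
    using F by (simp add: MU_def)
  have "F \<subseteq> H" if H: "cusco X H" "H \<subseteq> co_map X F" for H
  proof (rule ccontr)
    assume "\<not> F \<subseteq> H"
    then obtain x y where xy: "(x, y) \<in> F" "y \<notin> H `` {x}"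
      by auto
    have uH: "usco X H"
      using H by (simp add: cusco_def)
    have x: "x \<in> topspace X"
      using usco_subset[OF uF] xy by auto
    \<comment> \<open>A closed ball is taken so that its complement is open and upper semicontinuity
      of \<open>H\<close> applies to it.\<close>
    obtain e where e: "e > 0" "cball y e \<subseteq> - (H `` {x})"
      using xy(2) usco_compact[OF uH x] open_contains_cball[of "- (H `` {x})"]
      by (auto simp: compact_imp_closed)
    then obtain U where U: "openin X U" "x \<in> U" "\<And>u. u \<in> U \<Longrightarrow> H `` {u} \<subseteq> - cball y e"
      using usco_nbhd[OF uH x, of "- cball y e"] by (metis closed_cball compl_le_swap1 open_Compl)
    have "(x, y) \<in> F \<inter> U \<times> ball y e"
      using xy e U by auto
    then obtain w where w: "w \<in> U" "F `` {w} \<subseteq> ball y e"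
      using MU_box[OF F U(1), of "ball y e"] by (metis empty_iff open_ball)
    have wX: "w \<in> topspace X"
      using w U openin_subset by blast
    \<comment> \<open>The ball is convex, so it contains the hull of \<open>F(w)\<close> and with it
      \<open>H(w)\<close>.\<close>
    have "H `` {w} \<subseteq> ball y e"
      using H(2) hull_minimal[of _ _ convex, OF w(2) convex_ball] co_map_image[OF uF wX] by blast
    then show False
      using U(3)[OF w(1)] usco_nonempty[OF uH wX] ball_subset_cball[of y e] by blast
  qed
  then have "\<not> H \<subset> co_map X F" if "cusco X H" for H
    using co_map_subset_cusco[OF uF that] that by blast
  then show ?thesis
    using cusco_co_map[OF uF] by (auto simp: MC_def)
qed

lemma usco_Inter_chain:
  assumes ne: "\<C> \<noteq> {}" and us: "\<And>C. C \<in> \<C> \<Longrightarrow> usco X C"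
    and ch: "\<And>C D. C \<in> \<C> \<Longrightarrow> D \<in> \<C> \<Longrightarrow> C \<subseteq> D \<or> D \<subseteq> C"
  shows "usco X (\<Inter>\<C>)"
proof -
  have im: "\<Inter>\<C> `` {x} = (\<Inter>C\<in>\<C>. C `` {x})" for x
    using ne by auto
  \<comment> \<open>Otherwise the sets \<open>C(x) - V\<close> form a chain of nonempty compact
    sets, and a common point lies in the intersection but outside \<open>V\<close>.\<close>
  have small: "\<exists>C\<in>\<C>. C `` {x} \<subseteq> V" if x: "x \<in> topspace X" and V: "open V" "\<Inter>\<C> `` {x} \<subseteq> V" for x V
  proof (rule ccontr)
    assume contra: "\<not> ?thesis"
    have "\<Inter>((\<lambda>C. C `` {x} - V) ` \<C>) \<noteq> {}"
    proof (rule compact_chain)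
      show "compact S" if "S \<in> (\<lambda>C. C `` {x} - V) ` \<C>" for S
        using that usco_compact[OF us x] V(1) by (auto intro!: compact_diff)
      show "{} \<notin> (\<lambda>C. C `` {x} - V) ` \<C>"
        using contra by auto
      fix S T assume "S \<in> (\<lambda>C. C `` {x} - V) ` \<C> \<and> T \<in> (\<lambda>C. C `` {x} - V) ` \<C>"
      then obtain C D where CD: "C \<in> \<C>" "D \<in> \<C>" "S = C `` {x} - V" "T = D `` {x} - V"
        by auto
      from ch[OF CD(1,2)] show "S \<subseteq> T \<or> T \<subseteq> S"
        unfolding CD(3,4) by blast
    qed
    then show False
      using V(2) ne unfolding im by auto
  qed
  have "\<exists>U. openin X U \<and> x \<in> U \<and> (\<forall>u\<in>U. \<Inter>\<C> `` {u} \<subseteq> V)"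
    if x: "x \<in> topspace X" and V: "open V" "\<Inter>\<C> `` {x} \<subseteq> V" for x V
  proof -
    obtain C where C: "C \<in> \<C>" "C `` {x} \<subseteq> V"
      using small[OF x V] by auto
    then obtain U where "openin X U" "x \<in> U" "\<And>u. u \<in> U \<Longrightarrow> C `` {u} \<subseteq> V"
      using usco_nbhd[OF us x V(1)] by metis
    moreover have "\<Inter>\<C> `` {u} \<subseteq> C `` {u}" for u
      using C(1) by blast
    ultimately show ?thesis
      by (meson order_trans)
  qed
  \<comment> \<open>With \<open>V = {}\<close>, an empty intersection would make the value of a
    single member empty.\<close>
  moreover have "\<Inter>\<C> `` {x} \<noteq> {}" if "x \<in> topspace X" for x
    using small[OF that open_empty] usco_nonempty[OF us that] by blast
  moreover have "compact (\<Inter>\<C> `` {x})" if "x \<in> topspace X" for x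
    unfolding im using ne usco_compact[OF us that] by (intro compact_Inter) auto
  moreover have "\<Inter>\<C> \<subseteq> topspace X \<times> UNIV"
    using ne usco_subset[OF us] by blast
  ultimately show ?thesis
    by (simp add: usco_def usc_map_def)
qed

lemma usco_contains_MU:
  assumes "usco X G"
  obtains F where "F \<in> MU X" "F \<subseteq> G"
proof -
  \<comment> \<open>Complements turn minimal usco maps into maximal elements, the form in which
    Zorn's lemma is applied.\<close>
  define A where "A = uminus ` {F. usco X F \<and> F \<subseteq> G}"
  have "\<exists>M\<in>A. \<forall>N\<in>A. M \<subseteq> N \<longrightarrow> N = M"
  proof (rule subset_Zorn_nonempty)
    show "A \<noteq> {}"
      using assms by (auto simp: A_def)
    fix \<C> assume \<C>: "\<C> \<noteq> {}" "subset.chain A \<C>"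
    have "usco X (\<Inter>(uminus ` \<C>))"
    proof (rule usco_Inter_chain)
      fix C D assume "C \<in> uminus ` \<C>" "D \<in> uminus ` \<C>"
      then have "- C \<in> \<C>" "- D \<in> \<C>"
        by auto
      then have "- C \<subseteq> - D \<or> - D \<subseteq> - C"
        using \<C>(2) by (meson subset_chain_def)
      then show "C \<subseteq> D \<or> D \<subseteq> C"
        by blast
    qed (use \<C> in \<open>auto simp: subset.chain_def A_def\<close>)
    moreover have "\<Inter>(uminus ` \<C>) \<subseteq> G"
      using \<C> by (auto simp: subset.chain_def A_def)
    moreover have eq: "\<Union>\<C> = - \<Inter>(uminus ` \<C>)"
      by auto
    ultimately show "\<Union>\<C> \<in> A"
      unfolding eq A_def by (intro imageI CollectI conjI)
  qed
  then obtain M where M: "M \<in> A" "\<forall>N\<in>A. M \<subseteq> N \<longrightarrow> N = M"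
    by (elim bexE)
  from M(1) obtain F where F: "M = - F" and "F \<in> {F. usco X F \<and> F \<subseteq> G}"
    unfolding A_def by (rule imageE)
  then have F': "usco X F" "F \<subseteq> G"
    by simp_all
  have "H = F" if "usco X H" "H \<subseteq> F" for H
  proof -
    have "- H \<in> A"
      using that F'(2) by (auto simp: A_def)
    then show ?thesis
      using M(2)[rule_format, of "- H"] that(2) F by simp
  qed
  then show ?thesis
    using F' by (intro that[of F]) (auto simp: MU_def)
qed

text \<open>For surjectivity, choose a minimal usco \<open>F\<close> inside the given minimal cusco
  \<open>G\<close>. Its hull map is cusco and lies in \<open>G\<close>, so minimality of
  \<open>G\<close> gives equality.\<close>

lemma co_map_image_MU: "co_map X ` MU X = MC X"
proof (intro equalityI subsetI)
  fix G assume G: "G \<in> MC X"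
  then have cG: "cusco X G"
    by (simp add: MC_def)
  then obtain F where F: "F \<in> MU X" "F \<subseteq> G"
    using usco_contains_MU[of X G] by (auto simp: cusco_def)
  then have "usco X F"
    by (simp add: MU_def)
  then have "co_map X F = G"
    using co_map_subset_cusco[OF _ cG F(2)] cusco_co_map G by (auto simp: MC_def)
  then show "G \<in> co_map X ` MU X"
    using F by blast
qed (auto simp: co_map_MU)

section \<open>Continuity\<close>

lemma co_map_subset_open:
  assumes F: "usco X F" and W: "openin (prod_topology X euclideanreal) W" and FW: "co_map X F \<subseteq> W"
  obtains W' where "openin (prod_topology X euclideanreal) W'" "F \<subseteq> W'"
    "\<And>G. usco X G \<Longrightarrow> G \<subseteq> W' \<Longrightarrow> co_map X G \<subseteq> W"
proof -
  define \<B> where "\<B> = {(U, a, b). openin X U \<and> U \<times> {a<..<b} \<subseteq> W \<and> (\<forall>u\<in>U. F `` {u} \<subseteq> {a<..<b})}"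
  define W' where "W' = (\<Union>(U, a, b)\<in>\<B>. U \<times> {a<..<b})"
  have op: "openin (prod_topology X euclideanreal) W'"
    unfolding W'_def by (rule openin_Union) (auto simp: \<B>_def openin_prod_Times_iff)
  have sub: "F \<subseteq> W'"
  proof clarify
    fix x y assume xy: "(x, y) \<in> F"
    then have x: "x \<in> topspace X"
      using usco_subset[OF F] by auto
    have K: "compact (convex hull (F `` {x}))"
      by (intro compact_convex_hull usco_compact[OF F x])
    have "{x} \<times> (convex hull (F `` {x})) \<subseteq> W"
      using FW x co_map_image[OF F x] by auto
    \<comment> \<open>Compactness of the hull yields a whole open box around it inside
      \<open>W\<close>.\<close>
    then obtain U V where UV: "openin X U" "open V" "x \<in> U" "convex hull (F `` {x}) \<subseteq> V" "U \<times> V \<subseteq> W"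
      using Wallace_theorem_prod_topology[of X "{x}" euclideanreal "convex hull (F `` {x})" W] W K x
      by auto
    obtain a b where ab: "F `` {x} \<subseteq> {a<..<b}" "{a<..<b} \<subseteq> V"
      using compact_convex_hull_subset_interval usco_compact usco_nonempty F x UV by metis
    then obtain N where "openin X N" "x \<in> N" "\<And>u. u \<in> N \<Longrightarrow> F `` {u} \<subseteq> {a<..<b}"
      using usco_nbhd[OF F x, of "{a<..<b}"] by auto
    then have "(U \<inter> N, a, b) \<in> \<B>"
      using UV ab by (auto simp: \<B>_def)
    moreover have "(x, y) \<in> (U \<inter> N) \<times> {a<..<b}"
      using UV ab xy \<open>x \<in> N\<close> by auto
    ultimately show "(x, y) \<in> W'"
      unfolding W'_def by blast
  qed
  have "co_map X G \<subseteq> W" if G: "usco X G" "G \<subseteq> W'" for G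
  proof clarify
    fix u t assume ut: "(u, t) \<in> co_map X G"
    then have u: "u \<in> topspace X" and t: "t \<in> convex hull (G `` {u})"
      by (auto simp: co_map_iff[OF G(1)])
    obtain z where z: "z \<in> F `` {u}"
      using usco_nonempty[OF F u] by auto
    \<comment> \<open>This is the slice of \<open>W'\<close> over \<open>u\<close>. The set
      \<open>G(u)\<close> may be spread over several of its intervals, so convexity of the whole
      slice is needed; it follows from the common point \<open>z\<close>.\<close>
    define I where "I = (\<Union>(U, a, b)\<in>{B\<in>\<B>. u \<in> fst B}. {a<..<b})"
    have z: "z \<in> {a<..<b}" if "(U, a, b) \<in> \<B>" "u \<in> U" for U a b
      using that z unfolding \<B>_def by blast
    have "connected I"
      unfolding I_def
    proof (rule connected_Union)
      show "(\<Inter>(U, a, b)\<in>{B\<in>\<B>. u \<in> fst B}. {a<..<b}) \<noteq> {}"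
        using z by (intro ex_in_conv[THEN iffD1] exI[of _ z]) auto
    qed auto
    then have "convex I"
      using is_interval_connected_1 is_interval_convex_1 by blast
    moreover have "G `` {u} \<subseteq> I"
    proof
      fix y assume "y \<in> G `` {u}"
      then have "(u, y) \<in> W'"
        using G(2) by blast
      then obtain U a b where "(U, a, b) \<in> \<B>" "u \<in> U" "y \<in> {a<..<b}"
        unfolding W'_def by blast
      then show "y \<in> I"
        unfolding I_def by force
    qed
    ultimately have "t \<in> I"
      using t hull_minimal by blast
    then show "(u, t) \<in> W"
      unfolding I_def \<B>_def by auto
  qed
  then show ?thesis
    using that op sub by blast
qed

lemma co_map_meets_box:
  assumes G: "usco X G" and U: "openin X U" "connectedin X U" and "a < b"
    and lo: "G \<inter> U \<times> {..<b} \<noteq> {}" and hi: "G \<inter> U \<times> {a<..} \<noteq> {}"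
  shows "co_map X G \<inter> U \<times> {a<..<b} \<noteq> {}"
proof
  assume empty: "co_map X G \<inter> U \<times> {a<..<b} = {}"
  define H where "H = co_map X G"
  have H: "usco X H" "cusco X H"
    using cusco_co_map[OF G] by (auto simp: H_def cusco_def)
  \<comment> \<open>Over \<open>U\<close> the values of \<open>H\<close> avoid the gap between
    \<open>a\<close> and \<open>b\<close>, so lying below \<open>b\<close> means lying at or below
    \<open>a\<close>, and similarly for \<open>B\<close>. The strict inequalities make both
    conditions open.\<close>
  define A where "A = {u \<in> U. H `` {u} \<subseteq> {..<b}}"
  define B where "B = {u \<in> U. H `` {u} \<subseteq> {a<..}}"
  have UX: "U \<subseteq> topspace X"
    using U openin_subset by blast
  have opn: "openin X {u \<in> U. H `` {u} \<subseteq> V}" if "open V" for V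
  proof (subst openin_subopen, clarify)
    fix x assume x: "x \<in> U" "H `` {x} \<subseteq> V"
    then obtain N where "openin X N" "x \<in> N" "\<And>u. u \<in> N \<Longrightarrow> H `` {u} \<subseteq> V"
      using usco_nbhd[OF H(1), of x V] UX \<open>open V\<close> by (metis subsetD)
    then show "\<exists>T. openin X T \<and> x \<in> T \<and> T \<subseteq> {u \<in> U. H `` {u} \<subseteq> V}"
      using U x by (intro exI[of _ "N \<inter> U"]) auto
  qed
  have gap: "y \<le> a \<or> b \<le> y" if "u \<in> U" "y \<in> H `` {u}" for u y
    using empty that by (force simp: H_def)
  have "U \<subseteq> A \<union> B"
  proof
    fix u assume u: "u \<in> U"
    show "u \<in> A \<union> B"
    proof (rule ccontr)
      assume "u \<notin> A \<union> B"
      then obtain p q where pq: "p \<in> H `` {u}" "q \<in> H `` {u}" "p \<le> a" "b \<le> q"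
        using u unfolding A_def B_def by force
      have "is_interval (H `` {u})"
        using H(2) u UX by (auto simp: cusco_def is_interval_convex_1)
      \<comment> \<open>A convex value with points on both sides of the gap contains the midpoint of
        the gap.\<close>
      then have "(a + b) / 2 \<in> H `` {u}"
        using pq \<open>a < b\<close> mem_is_interval_1_I[of "H `` {u}" p q "(a + b) / 2"] by auto
      then show False
        using gap[OF u] \<open>a < b\<close> by force
    qed
  qed
  moreover have "A \<inter> B = {}"
  proof (rule ccontr)
    assume "A \<inter> B \<noteq> {}"
    then obtain u where u: "u \<in> U" "H `` {u} \<subseteq> {..<b}" "H `` {u} \<subseteq> {a<..}"
      by (auto simp: A_def B_def)
    then obtain y where "y \<in> H `` {u}"
      using usco_nonempty[OF H(1)] UX by blast
    then show False
      using gap[OF u(1), of y] u by force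
  qed
  moreover have "openin X A" "openin X B"
    unfolding A_def B_def by (intro opn; simp)+
  \<comment> \<open>A point of \<open>G\<close> over \<open>U\<close> below \<open>b\<close> is a
    value of \<open>H\<close>, hence at most \<open>a\<close>, which excludes its base point from
    \<open>B\<close>.\<close>
  moreover have "A \<inter> U \<noteq> {}"
  proof -
    obtain u y where "(u, y) \<in> G" "u \<in> U" "y < b"
      using lo by auto
    moreover from this have y: "y \<in> H `` {u}"
      using subset_co_map[OF G] by (auto simp: H_def)
    ultimately have "u \<notin> B"
      using gap[OF _ y] by (force simp: B_def)
    then show ?thesis
      using \<open>U \<subseteq> A \<union> B\<close> \<open>u \<in> U\<close> by auto
  qed
  moreover have "B \<inter> U \<noteq> {}"
  proof -
    obtain u y where "(u, y) \<in> G" "u \<in> U" "y > a"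
      using hi by auto
    moreover from this have y: "y \<in> H `` {u}"
      using subset_co_map[OF G] by (auto simp: H_def)
    ultimately have "u \<notin> A"
      using gap[OF _ y] by (force simp: A_def)
    then show ?thesis
      using \<open>U \<subseteq> A \<union> B\<close> \<open>u \<in> U\<close> by auto
  qed
  ultimately show False
    using U(2) unfolding connectedin by blast
qed

lemma co_map_meets_open:
  assumes X: "locally_connected_space X" and F: "usco X F"
    and V: "openin (prod_topology X euclideanreal) V" and FV: "co_map X F \<inter> V \<noteq> {}"
  shows "\<exists>\<V>. finite \<V> \<and> (\<forall>S\<in>\<V>. openin (prod_topology X euclideanreal) S \<and> F \<inter> S \<noteq> {}) \<and>
    (\<forall>G. usco X G \<longrightarrow> (\<forall>S\<in>\<V>. G \<inter> S \<noteq> {}) \<longrightarrow> co_map X G \<inter> V \<noteq> {})"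
proof -
  obtain x y where xy: "(x, y) \<in> V" "(x, y) \<in> co_map X F"
    using FV by auto
  obtain N O' where N: "openin X N" "open O'" "x \<in> N" "y \<in> O'" "N \<times> O' \<subseteq> V"
    using V xy(1) unfolding openin_prod_topology_alt by (metis open_openin)
  \<comment> \<open>Local connectedness enters here: the base of the box can be chosen
    connected.\<close>
  obtain U where U: "openin X U" "connectedin X U" "x \<in> U" "U \<subseteq> N"
    using X N unfolding locally_connected_space by meson
  obtain e where e: "e > 0" "ball y e \<subseteq> O'"
    using N open_contains_ball by metis
  have y: "y \<in> convex hull (F `` {x})"
    using xy by (auto simp: co_map_iff[OF F])
  \<comment> \<open>If \<open>F(x)\<close> lay entirely at or above \<open>y + e\<close>, so would
    its hull, which contains \<open>y\<close>. The bound \<open>hi\<close> is symmetric.\<close>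
  have lo: "F \<inter> U \<times> {..<y + e} \<noteq> {}"
  proof
    assume "F \<inter> U \<times> {..<y + e} = {}"
    then have "F `` {x} \<subseteq> {y + e..}"
      using U by force
    then have "y \<in> {y + e..}"
      using y hull_minimal[of "F `` {x}" "{y + e..}" convex] by auto
    then show False
      using e by auto
  qed
  have hi: "F \<inter> U \<times> {y - e<..} \<noteq> {}"
  proof
    assume "F \<inter> U \<times> {y - e<..} = {}"
    then have "F `` {x} \<subseteq> {..y - e}"
      using U by force
    then have "y \<in> {..y - e}"
      using y hull_minimal[of "F `` {x}" "{..y - e}" convex] by auto
    then show False
      using e by auto
  qed
  have "U \<times> {y - e<..<y + e} \<subseteq> V"
    using U N e by (auto simp: ball_eq_greaterThanLessThan)
  then have "co_map X G \<inter> V \<noteq> {}"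
    if "usco X G" "G \<inter> U \<times> {..<y + e} \<noteq> {}" "G \<inter> U \<times> {y - e<..} \<noteq> {}" for G
    using co_map_meets_box[OF that(1) U(1,2) _ that(2,3)] e by auto
  then show ?thesis
    using U lo hi by (intro exI[of _ "{U \<times> {..<y + e}, U \<times> {y - e<..}}"]) (auto simp: openin_prod_Times_iff)
qed

lemma continuous_map_co_map:
  assumes X: "locally_connected_space X"
  defines "Z \<equiv> prod_topology X euclideanreal"
  shows "continuous_map (subtopology (vietoris Z) (MU X)) (vietoris Z) (co_map X)"
proof -
  \<comment> \<open>Over an empty space the empty map is in \<open>MU X\<close> but not in
    \<open>CL Z\<close>; assuming \<open>F \<in> CL Z\<close> excludes this case.\<close>
  have CL: "co_map X F \<in> CL Z" if "F \<in> MU X" "F \<in> CL Z" for F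
  proof -
    have "usco X F" "F \<noteq> {}"
      using that by (auto simp: MU_def CL_def)
    moreover from this have "topspace X \<noteq> {}"
      using usco_subset by fastforce
    ultimately show ?thesis
      using usco_in_CL[of X "co_map X F"] cusco_co_map by (auto simp: cusco_def Z_def)
  qed
  have "openin (subtopology (vietoris Z) (MU X)) (co_map X -` \<Q> \<inter> (CL Z \<inter> MU X))"
    if "\<Q> \<in> vietoris_base Z" for \<Q>
  proof -
    obtain W \<W> where Q: "\<Q> = vietoris_basic Z W \<W>" "openin Z W" "finite \<W>" "\<And>V. V \<in> \<W> \<Longrightarrow> openin Z V"
      using \<open>\<Q> \<in> vietoris_base Z\<close> unfolding vietoris_base_def by blast
    show ?thesis
    proof (subst openin_subopen, clarify)
      fix F assume F: "co_map X F \<in> \<Q>" "F \<in> CL Z" "F \<in> MU X"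
      have uF: "usco X F"
        using F by (simp add: MU_def)
      have FQ: "co_map X F \<subseteq> W" "\<And>V. V \<in> \<W> \<Longrightarrow> co_map X F \<inter> V \<noteq> {}"
        using F(1) by (auto simp: Q(1) vietoris_basic_def)
      obtain W' where W': "openin Z W'" "F \<subseteq> W'" "\<And>G. usco X G \<Longrightarrow> G \<subseteq> W' \<Longrightarrow> co_map X G \<subseteq> W"
        using co_map_subset_open[OF uF Q(2)[unfolded Z_def] FQ(1)] unfolding Z_def by metis
      have "\<forall>V\<in>\<W>. \<exists>\<V>. finite \<V> \<and> (\<forall>S\<in>\<V>. openin Z S \<and> F \<inter> S \<noteq> {}) \<and>
          (\<forall>G. usco X G \<longrightarrow> (\<forall>S\<in>\<V>. G \<inter> S \<noteq> {}) \<longrightarrow> co_map X G \<inter> V \<noteq> {})"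
      proof
        fix V assume "V \<in> \<W>"
        from co_map_meets_open[OF X uF Q(4)[OF this, unfolded Z_def] FQ(2)[OF this]]
        show "\<exists>\<V>. finite \<V> \<and> (\<forall>S\<in>\<V>. openin Z S \<and> F \<inter> S \<noteq> {}) \<and>
            (\<forall>G. usco X G \<longrightarrow> (\<forall>S\<in>\<V>. G \<inter> S \<noteq> {}) \<longrightarrow> co_map X G \<inter> V \<noteq> {})"
          unfolding Z_def .
      qed
      from bchoice[OF this] obtain f where f: "\<forall>V\<in>\<W>. finite (f V) \<and> (\<forall>S\<in>f V. openin Z S \<and> F \<inter> S \<noteq> {}) \<and>
          (\<forall>G. usco X G \<longrightarrow> (\<forall>S\<in>f V. G \<inter> S \<noteq> {}) \<longrightarrow> co_map X G \<inter> V \<noteq> {})"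
        by (rule exE)
      \<comment> \<open>One finite family of open sets is chosen for each of the finitely many sets
        to be met, so their union is again finite and, with \<open>W'\<close>, defines a basic
        neighborhood of \<open>F\<close>.\<close>
      define \<N> where "\<N> = vietoris_basic Z W' (\<Union>(f ` \<W>))"
      have "\<N> \<in> vietoris_base Z"
        unfolding vietoris_base_def \<N>_def
      proof (intro CollectI exI[of _ W'] exI[of _ "\<Union>(f ` \<W>)"] conjI refl)
        show "finite (\<Union>(f ` \<W>))"
          using f Q(3) by blast
        show "\<forall>S\<in>\<Union>(f ` \<W>). openin Z S"
          using f by blast
      qed (rule W'(1))
      then have "openin (vietoris Z) \<N>"
        unfolding vietoris_def by (rule topology_generated_by_Basis)
      then have "openin (subtopology (vietoris Z) (MU X)) (\<N> \<inter> MU X)"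
        by (rule openin_subtopology_Int)
      moreover have "F \<in> \<N> \<inter> MU X"
        using F W' f by (auto simp: \<N>_def vietoris_basic_def)
      moreover have "\<N> \<inter> MU X \<subseteq> co_map X -` \<Q> \<inter> (CL Z \<inter> MU X)"
      proof
        fix G assume "G \<in> \<N> \<inter> MU X"
        then have G: "G \<in> MU X" "G \<in> CL Z" "G \<subseteq> W'" "\<And>V S. V \<in> \<W> \<Longrightarrow> S \<in> f V \<Longrightarrow> G \<inter> S \<noteq> {}"
          by (auto simp: \<N>_def vietoris_basic_def)
        moreover have "usco X G"
          using G by (simp add: MU_def)
        ultimately show "G \<in> co_map X -` \<Q> \<inter> (CL Z \<inter> MU X)"
          using W'(3) f CL by (auto simp: Q(1) vietoris_basic_def)
      qed
      ultimately show "\<exists>\<T>. openin (subtopology (vietoris Z) (MU X)) \<T> \<and> F \<in> \<T> \<and>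
          \<T> \<subseteq> co_map X -` \<Q> \<inter> (CL Z \<inter> MU X)"
        by blast
    qed
  qed
  moreover have "\<Union>(vietoris_base Z) = CL Z"
    using topspace_vietoris[of Z] unfolding vietoris_def topology_generated_by_topspace .
  ultimately show ?thesis
    unfolding vietoris_def continuous_on_generated_topo_iff
    using CL by auto
qed

theorem theorem3p4:
  fixes X :: "'a topology"
  assumes "locally_connected_space X" and "Hausdorff_space X"
  shows "co_map X ` MU X = MC X \<and>
    continuous_map
      (subtopology (vietoris (prod_topology X euclideanreal)) (MU X))
      (subtopology (vietoris (prod_topology X euclideanreal)) (MC X))
      (co_map X)"
  using continuous_map_co_map[OF assms(1)] co_map_MU
  by (auto simp: co_map_image_MU continuous_map_in_subtopology)

end
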